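(* Let $V$ be a vector space over a field $F$, let $W\subset GL(V)$ be a reflection group and let $\mathcal{B}$ be a system of subspaces for $W$. Then $$|M(W,\mathcal{B})|=\sum_{X\in\mathcal{B}}[W:W_X],$$ where $W_X\subset W$ is the isotropy group of $X\in\mathcal{B}$.
   Context: Maps are written on the right and composed from left to right. A reflection is a non-trivial element of finite order in $GL(V)$ that is semisimple and leaves pointwise invariant a hyperplane of $V$; a subgroup of $GL(V)$ is a reflection group if it is generated by reflections. For a group $G\subset GL(V)$, a system of subspaces for $G$ is a collection $\mathcal{B}$ of subspaces of $V$ such that (S1) $V\in\mathcal{B}$; (S2) $Xg\in\mathcal{B}$ for all $X\in\mathcal{B}$, $g\in G$; (S3) $X\cap Y\in\mathcal{B}$ for all $X,Y\in\mathcal{B}$. $M(W,\mathcal{B})=\{g_X \mid g\in W,\ X\in\mathcal{B}\}$, where $g_X:X\to Xg$ denotes the restriction of $g$ to $X$. It is a monoid of partial linear isomorphisms of $V$ under composition of partial maps; two elements are equal iff they have the same domain and agree on it. The isotropy group $W_X$ consists of the elements of $W$ that fix $X$ pointwise. If the quantities involved are infinite, the equality is one of cardinal numbers. *)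

theory Defs
  imports Complex_Main "HOL-Algebra.Generated_Groups"
begin

unbundle cardinal_syntax

text \<open>
  The vector space \<open>V\<close> is the whole type \<open>'v\<close>, with scalar multiplication \<open>scale\<close>; no finiteness
  of dimension is assumed.  Maps act on the right and are composed from left to right, so a product
  \<open>f \<otimes> g\<close> means \<open>f\<close> first, then \<open>g\<close>.
\<close>

definition GL :: "('f::field \<Rightarrow> 'v::ab_group_add \<Rightarrow> 'v) \<Rightarrow> ('v \<Rightarrow> 'v) monoid" where
  "GL scale = \<lparr>carrier = {g. Vector_Spaces.linear scale scale g \<and> bij g},
               mult = (\<lambda>f g. g \<circ> f), one = id\<rparr>"

lemma group_GL:
  assumes "vector_space scale"
  shows "group (GL scale)"
proof -
  interpret V: vector_space scale by (rule assms)
  interpret VV: vector_space_pair scale scale by unfold_locales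
  show ?thesis
  proof (rule groupI)
    fix x assume "x \<in> carrier (GL scale)"
    then have lin: "Vector_Spaces.linear scale scale x" and bij: "bij x" by (auto simp: GL_def)
    obtain y where y: "Vector_Spaces.linear scale scale y" "y \<circ> x = id"
      using VV.linear_injective_left_inverse[OF lin] bij by (auto simp: bij_def)
    have "x \<circ> y = id"
      using y(2) bij by (metis bij_is_surj surj_iff comp_assoc comp_id id_comp)
    then have "bij y" using y(2) by (metis o_bij)
    then show "\<exists>y\<in>carrier (GL scale). y \<otimes>\<^bsub>GL scale\<^esub> x = \<one>\<^bsub>GL scale\<^esub>"
      using y(1) \<open>x \<circ> y = id\<close> by (auto simp: GL_def)
  qed (auto simp: GL_def V.linear_id bij_comp comp_assoc intro: Vector_Spaces.linear_compose)
qed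

text \<open>A hyperplane is a linear subspace of codimension one.\<close>

definition hyperplane :: "('f::field \<Rightarrow> 'v::ab_group_add \<Rightarrow> 'v) \<Rightarrow> 'v set \<Rightarrow> bool" where
  "hyperplane scale H \<longleftrightarrow> module.subspace scale H \<and>
     (\<exists>v. v \<notin> H \<and> module.span scale (insert v H) = UNIV)"

text \<open>A linear map \<open>g\<close> is semisimple if \<open>V\<close> is a semisimple module over the polynomials in \<open>g\<close>:
  every invariant subspace has an invariant complement.\<close>

definition semisimple :: "('f::field \<Rightarrow> 'v::ab_group_add \<Rightarrow> 'v) \<Rightarrow> ('v \<Rightarrow> 'v) \<Rightarrow> bool" where
  "semisimple scale g \<longleftrightarrow>
     (\<forall>U. module.subspace scale U \<and> g ` U \<subseteq> U \<longrightarrow>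
       (\<exists>U'. module.subspace scale U' \<and> g ` U' \<subseteq> U' \<and>
             U \<inter> U' = {0} \<and> {u + u' | u u'. u \<in> U \<and> u' \<in> U'} = UNIV))"

definition reflection :: "('f::field \<Rightarrow> 'v::ab_group_add \<Rightarrow> 'v) \<Rightarrow> ('v \<Rightarrow> 'v) \<Rightarrow> bool" where
  "reflection scale s \<longleftrightarrow>
     s \<in> carrier (GL scale) \<and> s \<noteq> \<one>\<^bsub>GL scale\<^esub> \<and>
     (\<exists>n::nat. n > 0 \<and> s [^]\<^bsub>GL scale\<^esub> n = \<one>\<^bsub>GL scale\<^esub>) \<and>
     semisimple scale s \<and>
     (\<exists>H. hyperplane scale H \<and> (\<forall>x\<in>H. s x = x))"

definition reflection_group :: "('f::field \<Rightarrow> 'v::ab_group_add \<Rightarrow> 'v) \<Rightarrow> ('v \<Rightarrow> 'v) set \<Rightarrow> bool" where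
  "reflection_group scale W \<longleftrightarrow>
     subgroup W (GL scale) \<and>
     (\<exists>S \<subseteq> {s. reflection scale s}. W = generate (GL scale) S)"

definition subspace_system ::
  "('f::field \<Rightarrow> 'v::ab_group_add \<Rightarrow> 'v) \<Rightarrow> ('v \<Rightarrow> 'v) set \<Rightarrow> 'v set set \<Rightarrow> bool" where
  "subspace_system scale G \<B> \<longleftrightarrow>
     (\<forall>X\<in>\<B>. module.subspace scale X) \<and>
     UNIV \<in> \<B> \<and>
     (\<forall>X\<in>\<B>. \<forall>g\<in>G. g ` X \<in> \<B>) \<and>
     (\<forall>X\<in>\<B>. \<forall>Y\<in>\<B>. X \<inter> Y \<in> \<B>)"

text \<open>Partial maps of \<open>V\<close> are functions into \<open>'v option\<close>; two of them are equal iff they have the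
  same domain and agree on it.  The restriction \<open>g\<^sub>X\<close> has domain exactly \<open>X\<close>.\<close>

definition restr :: "('v \<Rightarrow> 'v) \<Rightarrow> 'v set \<Rightarrow> 'v \<rightharpoonup> 'v" where
  "restr g X = (Some \<circ> g) |` X"

definition M :: "('v \<Rightarrow> 'v) set \<Rightarrow> 'v set set \<Rightarrow> ('v \<rightharpoonup> 'v) monoid" where
  "M W \<B> = \<lparr>carrier = {restr g X | g X. g \<in> W \<and> X \<in> \<B>},
            mult = (\<lambda>\<alpha> \<beta>. \<beta> \<circ>\<^sub>m \<alpha>), one = restr id UNIV\<rparr>"

text \<open>The product of two restrictions: \<open>g\<^sub>X h\<^sub>Y = (g h)\<^sub>Z\<close> with \<open>Z = X \<inter> Y g\<inverse>\<close>.\<close>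

lemma restr_comp: "restr h Y \<circ>\<^sub>m restr g X = restr (h \<circ> g) (X \<inter> g -` Y)"
  by (auto simp: restr_def map_comp_def restrict_map_def fun_eq_iff)

lemma monoid_M:
  assumes V: "vector_space scale" and W: "subgroup W (GL scale)"
    and B: "subspace_system scale W \<B>"
  shows "monoid (M W \<B>)"
proof -
  interpret G: group "GL scale" by (rule group_GL[OF V])
  have one: "id \<in> W" using subgroup.one_closed[OF W] by (simp add: GL_def)
  have mult: "h \<circ> g \<in> W" if "g \<in> W" "h \<in> W" for g h
    using subgroup.m_closed[OF W that] by (simp add: GL_def)
  have vim: "g -` Y \<in> \<B>" if g: "g \<in> W" and Y: "Y \<in> \<B>" for g Y
  proof -
    let ?k = "inv\<^bsub>GL scale\<^esub> g"
    have k: "?k \<in> W" using subgroup.m_inv_closed[OF W g] .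
    have gc: "g \<in> carrier (GL scale)" using subgroup.mem_carrier[OF W g] .
    have gk: "\<And>x. g (?k x) = x" "\<And>x. ?k (g x) = x"
      using G.l_inv[OF gc] G.r_inv[OF gc] by (auto simp: GL_def fun_eq_iff)
    have "g -` Y = ?k ` Y"
    proof (intro equalityI subsetI)
      fix x assume "x \<in> g -` Y"
      then show "x \<in> ?k ` Y" using gk(2)[of x] by (metis image_eqI vimageE)
    qed (auto simp: gk)
    then show ?thesis using k Y B by (simp add: subspace_system_def)
  qed
  have cap: "X \<inter> Y \<in> \<B>" if "X \<in> \<B>" "Y \<in> \<B>" for X Y
    using B that by (simp add: subspace_system_def)
  show ?thesis
  proof (rule monoidI)
    fix x y assume "x \<in> carrier (M W \<B>)" "y \<in> carrier (M W \<B>)"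
    then obtain g X h Y where *: "x = restr g X" "g \<in> W" "X \<in> \<B>" "y = restr h Y" "h \<in> W" "Y \<in> \<B>"
      by (auto simp: M_def)
    then show "x \<otimes>\<^bsub>M W \<B>\<^esub> y \<in> carrier (M W \<B>)"
      using mult vim cap by (simp add: M_def restr_comp) blast
  next
    show "\<one>\<^bsub>M W \<B>\<^esub> \<in> carrier (M W \<B>)"
      using one B by (auto simp: M_def subspace_system_def)
  qed (auto simp: M_def restr_def map_comp_def restrict_map_def fun_eq_iff split: option.splits)
qed

definition isotropy :: "('v \<Rightarrow> 'v) set \<Rightarrow> 'v set \<Rightarrow> ('v \<Rightarrow> 'v) set" where
  "isotropy W X = {g \<in> W. \<forall>x\<in>X. g x = x}"

lemma subgroup_isotropy:
  assumes V: "vector_space scale" and W: "subgroup W (GL scale)"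
  shows "subgroup (isotropy W X) (GL scale\<lparr>carrier := W\<rparr>)"
proof -
  interpret G: group "GL scale" by (rule group_GL[OF V])
  have "subgroup (isotropy W X) (GL scale)"
  proof (rule G.subgroupI)
    show "isotropy W X \<subseteq> carrier (GL scale)"
      using subgroup.subset[OF W] by (auto simp: isotropy_def)
    show "isotropy W X \<noteq> {}"
      using subgroup.one_closed[OF W] by (auto simp: isotropy_def GL_def intro!: exI[of _ id])
  next
    fix a assume a: "a \<in> isotropy W X"
    then have aW: "a \<in> W" and ac: "a \<in> carrier (GL scale)"
      using subgroup.mem_carrier[OF W] by (auto simp: isotropy_def)
    have i: "(inv\<^bsub>GL scale\<^esub> a) (a x) = x" for x
      using G.r_inv[OF ac] by (auto simp: GL_def fun_eq_iff)
    have "(inv\<^bsub>GL scale\<^esub> a) x = x" if "x \<in> X" for x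
      using i[of x] a that by (simp add: isotropy_def)
    then show "inv\<^bsub>GL scale\<^esub> a \<in> isotropy W X"
      using subgroup.m_inv_closed[OF W aW] by (simp add: isotropy_def)
  next
    fix a b assume "a \<in> isotropy W X" "b \<in> isotropy W X"
    then show "a \<otimes>\<^bsub>GL scale\<^esub> b \<in> isotropy W X"
      using subgroup.m_closed[OF W] by (auto simp: isotropy_def GL_def)
  qed
  then show ?thesis
    by (rule G.subgroup_incl[OF _ W]) (auto simp: isotropy_def)
qed

text \<open>The index \<open>[G : H]\<close> as a cardinal number: for infinite index the natural number
  \<open>card (rcosets H)\<close> would be the junk value \<open>0\<close>.\<close>

definition index :: "('a, 'b) monoid_scheme \<Rightarrow> 'a set \<Rightarrow> 'a set rel" where
  "index G H = |rcosets\<^bsub>G\<^esub> H|"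

end

theory Submission
  imports Defs
begin

text \<open>
  An element \<open>g\<^sub>X\<close> of \<open>M(W, \<B>)\<close> remembers its domain \<open>X\<close>, so the monoid is the disjoint union over
  \<open>X \<in> \<B>\<close> of the sets of maps \<open>g\<^sub>X\<close> with \<open>g \<in> W\<close>.  For a fixed \<open>X\<close>, the elements \<open>g\<close> and \<open>h\<close>
  have the same restriction to \<open>X\<close> iff \<open>h g\<inverse>\<close> (first \<open>h\<close>, then \<open>g\<inverse>\<close>) fixes \<open>X\<close> pointwise, that
  is, iff \<open>W\<^sub>X g = W\<^sub>X h\<close>.  Thus each fibre of the restriction map \<open>g \<mapsto> g\<^sub>X\<close> is a right coset of
  \<open>W\<^sub>X\<close> (lemma \<open>r_coset_isotropy_eq\<close>), and sending a partial map to its domain together with its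
  fibre is a bijection from \<open>M(W, \<B>)\<close> onto the disjoint union of the coset spaces of the \<open>W\<^sub>X\<close>.
  As the argument exhibits a bijection, it proves the equality of cardinals in the infinite case
  too.
\<close>

lemma dom_restr [simp]: "dom (restr g X) = X"
  by (auto simp: restr_def)

lemma restr_eq_iff: "restr g X = restr h X \<longleftrightarrow> (\<forall>x\<in>X. g x = h x)"
  by (auto simp: restr_def restrict_map_def fun_eq_iff)

text \<open>
  Maps compose from left to right, so the members \<open>h \<otimes> a\<close> of a right coset act by \<open>h\<close> first; for
  \<open>h\<close> in the isotropy group this does not change the value on \<open>X\<close>.
\<close>

lemma r_coset_isotropy_eq:
  assumes V: "vector_space scale" and W: "subgroup W (GL scale)" and a: "a \<in> W"
  shows "isotropy W X #>\<^bsub>GL scale\<lparr>carrier := W\<rparr>\<^esub> a = {g \<in> W. restr g X = restr a X}"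
proof (intro equalityI subsetI)
  fix g assume "g \<in> isotropy W X #>\<^bsub>GL scale\<lparr>carrier := W\<rparr>\<^esub> a"
  then obtain h where "h \<in> isotropy W X" "g = h \<otimes>\<^bsub>GL scale\<^esub> a"
    by (auto simp: r_coset_def)
  then show "g \<in> {g \<in> W. restr g X = restr a X}"
    using subgroup.m_closed[OF W _ a] by (auto simp: isotropy_def restr_eq_iff GL_def)
next
  interpret G: group "GL scale" by (rule group_GL[OF V])
  fix g assume "g \<in> {g \<in> W. restr g X = restr a X}"
  then have g: "g \<in> W" and eq: "\<And>x. x \<in> X \<Longrightarrow> g x = a x"
    by (auto simp: restr_eq_iff)
  define h where "h = g \<otimes>\<^bsub>GL scale\<^esub> inv\<^bsub>GL scale\<^esub> a"
  have ac: "a \<in> carrier (GL scale)" and gc: "g \<in> carrier (GL scale)"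
    using a g subgroup.mem_carrier[OF W] by auto
  have "(inv\<^bsub>GL scale\<^esub> a) (a x) = x" for x
    using G.r_inv[OF ac] by (auto simp: GL_def fun_eq_iff)
  then have "h x = x" if "x \<in> X" for x
    using eq[OF that] by (simp add: h_def GL_def)
  moreover have "h \<in> W"
    unfolding h_def by (intro subgroup.m_closed[OF W] subgroup.m_inv_closed[OF W] a g)
  ultimately have "h \<in> isotropy W X"
    by (simp add: isotropy_def)
  moreover have "g = h \<otimes>\<^bsub>GL scale\<^esub> a"
    using ac gc by (simp add: h_def G.m_assoc)
  ultimately show "g \<in> isotropy W X #>\<^bsub>GL scale\<lparr>carrier := W\<rparr>\<^esub> a"
    by (auto simp: r_coset_def)
qed

lemma rcosets_isotropy_eq:
  assumes "vector_space scale" "subgroup W (GL scale)"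
  shows "rcosets\<^bsub>GL scale\<lparr>carrier := W\<rparr>\<^esub> (isotropy W X)
    = (\<lambda>a. {g \<in> W. restr g X = restr a X}) ` W"
  using r_coset_isotropy_eq[OF assms] by (auto simp: RCOSETS_def)

lemma image_Pair_eq_Sigma: "(\<lambda>(x, y). (x, f x y)) ` (A \<times> B) = (SIGMA x : A. f x ` B)"
  by force

text \<open>
  Going from partial maps to cosets, rather than back, avoids a choice of coset representatives.
\<close>

lemma bij_betw_M_cosets:
  assumes "vector_space scale" "subgroup W (GL scale)"
  shows "bij_betw (\<lambda>m. (dom m, {g \<in> W. restr g (dom m) = m})) (carrier (M W \<B>))
    (SIGMA X : \<B>. rcosets\<^bsub>GL scale\<lparr>carrier := W\<rparr>\<^esub> (isotropy W X))"
    (is "bij_betw ?\<phi> _ ?C")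
proof (rule bij_betw_imageI)
  show "inj_on ?\<phi> (carrier (M W \<B>))"
  proof (rule inj_onI)
    fix m n assume m: "m \<in> carrier (M W \<B>)" and eq: "?\<phi> m = ?\<phi> n"
    have D: "dom m = dom n"
      using arg_cong[OF eq, of fst] by (simp only: fst_conv)
    have F: "{g \<in> W. restr g (dom m) = m} = {g \<in> W. restr g (dom n) = n}"
      using arg_cong[OF eq, of snd] by (simp only: snd_conv)
    \<comment> \<open>The fibre of \<open>m\<close> is nonempty, and any of its members restricts to both \<open>m\<close> and \<open>n\<close>.\<close>
    obtain g where "g \<in> W" "restr g (dom m) = m"
      using m by (auto simp: M_def)
    then have "g \<in> {g \<in> W. restr g (dom n) = n}"
      unfolding F[symmetric] by blast
    with \<open>restr g (dom m) = m\<close> D show "m = n" by simp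
  qed
  show "?\<phi> ` carrier (M W \<B>) = ?C"
  proof -
    have "carrier (M W \<B>) = (\<lambda>(X, a). restr a X) ` (\<B> \<times> W)"
      unfolding M_def by auto
    then have "?\<phi> ` carrier (M W \<B>) = (\<lambda>(X, a). (X, {g \<in> W. restr g X = restr a X})) ` (\<B> \<times> W)"
      by (simp add: image_image split_def)
    also have "\<dots> = (SIGMA X : \<B>. (\<lambda>a. {g \<in> W. restr g X = restr a X}) ` W)"
      by (rule image_Pair_eq_Sigma)
    also have "\<dots> = ?C"
      by (simp only: rcosets_isotropy_eq[OF assms])
    finally show ?thesis .
  qed
qed

theorem theorem1:
  fixes scale :: "'f::field \<Rightarrow> 'v::ab_group_add \<Rightarrow> 'v"
    and W :: "('v \<Rightarrow> 'v) set" and \<B> :: "'v set set"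
  assumes "vector_space scale"
    and "reflection_group scale W"
    and "subspace_system scale W \<B>"
  shows "|carrier (M W \<B>)| =o (CSUM X : |\<B>|. index (GL scale\<lparr>carrier := W\<rparr>) (isotropy W X))"
proof -
  have "subgroup W (GL scale)"
    using assms(2) by (simp add: reflection_group_def)
  from bij_betw_M_cosets[OF assms(1) this]
  show ?thesis
    unfolding Csum_def index_def Field_card_of by (rule card_of_ordIsoI)
qed

end
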